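(* For every $\sigma>1$, $$N_x^\sigma\subset\mathcal E_\sigma^{\Gamma}\subset\mathcal E_\sigma .$$
   Context: $\hat f$ denotes the Fourier transform of $f$. For $\sigma>1$ define $$N_x^\sigma:=\left\{f\in L^2(\mathbb R)\ \Big|\ \exp\left\{\rho\,\log^{\frac{\sigma}{\sigma-1}}|\xi|\right\}|\hat f(\xi)|\le C\ \text{ for some }\rho>0\right\},$$ where $C$ denotes a positive constant. $W$ is the principal branch of the Lambert $W$ function (the inverse of $z\mapsto ze^z$), and $$g_\sigma(x)=\frac{\ln^{\frac{\sigma}{\sigma-1}}(1+|x|)}{W^{\frac1{\sigma-1}}(\ln(1+|x|))},\quad x\in\mathbb R,\qquad g_\sigma(0)=0.$$ A continuous function $\phi$ belongs to $\mathbf\Gamma_\sigma(\mathbb R)$ if there exist $\rho>0$ and $C>0$ such that $|\phi(x)|\le Ce^{-\rho g_\sigma(x)}$ for all $x\in\mathbb R$. Set $$\mathcal E_\sigma^\Gamma=\{f\in L^2(\mathbb R)\mid \hat f\in\mathbf\Gamma_\sigma(\mathbb R)\}.$$ $\mathcal E_\sigma=\mathcal E_\sigma(\mathbb R)$ is the extended Gevrey class: for $\tau>0$, $\sigma>1$ let $M_0^{\tau,\sigma}=1$ and $M_p^{\tau,\sigma}=p^{\tau p^{\sigma}}$ for $p\in\mathbb N=\{1,2,\dots\}$. A smooth function $\phi$ belongs to $\mathcal E_{\tau,\sigma}(\mathbb R)$ if for every compact $\mathbb K\subset\mathbb R$ there is $C>0$ such that $\sup_{x\in\mathbb K}|\phi^{(p)}(x)|\le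 C^{p^{\sigma}+1}M_p^{\tau,\sigma}$ for all $p\in\mathbb N_0$. Then $\mathcal E_\sigma(\mathbb R)=\bigcup_{\tau>0}\mathcal E_{\tau,\sigma}(\mathbb R)$.
   Formalization: The class N_x^σ is restricted to f whose Fourier transform has a continuous representative satisfying the bound (for |ξ|≥1); without continuity the first inclusion fails, e.g. for f̂ the indicator of [1,2], since Γ_σ contains only continuous functions. *)

theory Defs
  imports "HOL-Analysis.Analysis"
begin

text \<open>Elements of \<open>L\<^sup>2(\<real>)\<close> are represented by complex-valued Borel functions; equality in
  \<open>L\<^sup>2(\<real>)\<close> is equality almost everywhere.\<close>

definition square_integrable :: "(real \<Rightarrow> complex) \<Rightarrow> bool" where
  "square_integrable f \<longleftrightarrow>
     f \<in> borel_measurable lborel \<and> integrable lborel (\<lambda>x. (cmod (f x))\<^sup>2)"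

definition truncated_fourier :: "(real \<Rightarrow> complex) \<Rightarrow> real \<Rightarrow> real \<Rightarrow> complex" where
  "truncated_fourier f R \<xi> = (LINT x:{-R..R}|lborel. f x * cis (- (2 * pi * x * \<xi>)))"

text \<open>The Fourier transform on \<open>L\<^sup>2(\<real>)\<close> is the \<open>L\<^sup>2\<close>-limit of the truncated Fourier integrals
  (with kernel \<open>exp (-2 \<pi> i x \<xi>)\<close>). It is determined only up to null sets, so it is given as a
  relation: \<open>F\<close> is a representative of the Fourier transform of \<open>f\<close>. The nonnegative integral is
  used because it is infinite, rather than 0, when the integrand is not integrable.\<close>

definition is_L2_fourier :: "(real \<Rightarrow> complex) \<Rightarrow> (real \<Rightarrow> complex) \<Rightarrow> bool" where
  "is_L2_fourier f F \<longleftrightarrow>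
     square_integrable F \<and>
     ((\<lambda>R. \<integral>\<^sup>+ \<xi>. ennreal ((cmod (F \<xi> - truncated_fourier f R \<xi>))\<^sup>2) \<partial>lborel) \<longlongrightarrow> 0) at_top"

text \<open>The bound is imposed at points, hence on a continuous representative of the Fourier
  transform; an almost-everywhere bound alone would admit Fourier transforms such as the indicator
  of an interval, which have no continuous representative. It is required for
  \<open>\<bar>\<xi>\<bar> \<ge> 1\<close> only, where the real power of \<open>ln \<bar>\<xi>\<bar>\<close> is defined.\<close>

definition N_class :: "real \<Rightarrow> (real \<Rightarrow> complex) set" where
  "N_class \<sigma> = {f. square_integrable f \<and>
     (\<exists>\<phi>. is_L2_fourier f \<phi> \<and> continuous_on UNIV \<phi> \<and>
       (\<exists>\<rho>>0. \<exists>C>0. \<forall>\<xi>. \<bar>\<xi>\<bar> \<ge> 1 \<longrightarrow>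
          exp (\<rho> * ln \<bar>\<xi>\<bar> powr (\<sigma> / (\<sigma> - 1))) * cmod (\<phi> \<xi>) \<le> C))}"

text \<open>Real principal branch, meaningful for \<open>y \<ge> - exp (-1)\<close>.\<close>

definition Lambert_W :: "real \<Rightarrow> real" where
  "Lambert_W y = (THE w. w \<ge> -1 \<and> w * exp w = y)"

definition g_fun :: "real \<Rightarrow> real \<Rightarrow> real" where
  "g_fun \<sigma> x = (if x = 0 then 0
     else ln (1 + \<bar>x\<bar>) powr (\<sigma> / (\<sigma> - 1)) / Lambert_W (ln (1 + \<bar>x\<bar>)) powr (1 / (\<sigma> - 1)))"

definition Gamma_class :: "real \<Rightarrow> (real \<Rightarrow> complex) set" where
  "Gamma_class \<sigma> = {\<phi>. continuous_on UNIV \<phi> \<and>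
     (\<exists>\<rho>>0. \<exists>C>0. \<forall>x. cmod (\<phi> x) \<le> C * exp (- \<rho> * g_fun \<sigma> x))}"

definition E_Gamma :: "real \<Rightarrow> (real \<Rightarrow> complex) set" where
  "E_Gamma \<sigma> = {f. square_integrable f \<and> (\<exists>\<phi>\<in>Gamma_class \<sigma>. is_L2_fourier f \<phi>)}"

definition nth_deriv :: "nat \<Rightarrow> (real \<Rightarrow> complex) \<Rightarrow> real \<Rightarrow> complex" where
  "nth_deriv p \<phi> = ((\<lambda>h x. vector_derivative h (at x)) ^^ p) \<phi>"

definition smooth :: "(real \<Rightarrow> complex) \<Rightarrow> bool" where
  "smooth \<phi> \<longleftrightarrow> (\<forall>p x. nth_deriv p \<phi> differentiable (at x))"

text \<open>The case \<open>p = 0\<close> is separate because \<open>0 powr 0 = 0\<close>.\<close>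

definition M_seq :: "real \<Rightarrow> real \<Rightarrow> nat \<Rightarrow> real" where
  "M_seq \<tau> \<sigma> p = (if p = 0 then 1 else real p powr (\<tau> * real p powr \<sigma>))"

definition ext_Gevrey_tau :: "real \<Rightarrow> real \<Rightarrow> (real \<Rightarrow> complex) set" where
  "ext_Gevrey_tau \<tau> \<sigma> = {\<phi>. smooth \<phi> \<and>
     (\<forall>K. compact K \<longrightarrow>
       (\<exists>C>0. \<forall>p. \<forall>x\<in>K. cmod (nth_deriv p \<phi> x) \<le> C powr (real p powr \<sigma> + 1) * M_seq \<tau> \<sigma> p))}"

definition ext_Gevrey :: "real \<Rightarrow> (real \<Rightarrow> complex) set" where
  "ext_Gevrey \<sigma> = (\<Union>\<tau>\<in>{0<..}. ext_Gevrey_tau \<tau> \<sigma>)"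

end

theory Submission
  imports Defs "HOL-Probability.Probability"
begin

text \<open>
  Since \<open>y / W y = exp (W y)\<close>, the weight is \<open>g\<^sub>\<sigma>(x) = y * exp (W y / (\<sigma> - 1))\<close> with
  \<open>y = ln (1 + \<bar>x\<bar>)\<close>. As \<open>W\<close> is bounded below by a positive constant away from \<open>0\<close>, \<open>g\<^sub>\<sigma>\<close> is
  dominated by a multiple of \<open>ln\<^bsup>\<sigma>/(\<sigma>-1)\<^esup>\<bar>x\<bar>\<close> for \<open>\<bar>x\<bar> \<ge> 2\<close>, which gives the first inclusion.

  For the second one, let \<open>\<phi>\<close> represent the Fourier transform of \<open>f\<close>. Maximising
  \<open>(1 + \<bar>\<xi>\<bar>)\<^bsup>p+2\<^esup> exp (- \<rho> g\<^sub>\<sigma>(\<xi>))\<close> over \<open>\<xi>\<close> yields bounds of extended Gevrey type for the moments of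
  \<open>\<phi>\<close>, hence for the derivatives of its inverse Fourier transform \<open>\<psi>\<close>. To see that \<open>f = \<psi>\<close> almost
  everywhere, pair \<open>\<phi>\<close> with translates of a Gaussian: by Fubini, \<open>f\<close> and \<open>\<psi>\<close> multiplied by the
  Gaussian are integrable functions with the same Fourier transform, and such functions agree by
  Levy's uniqueness theorem.
\<close>

subsection \<open>The Lambert function and the weight\<close>

text \<open>A competitor \<open>v\<close> has \<open>v * exp v \<ge> 0\<close>, hence
  \<open>v \<ge> 0\<close>, and on that half-line the map is strictly increasing; so the definite
  description is well determined.\<close>

lemma Lambert_W_mult_exp:
  assumes "w \<ge> 0"
  shows "Lambert_W (w * exp w) = w"
  unfolding Lambert_W_def
proof (rule the_equality)
  show "w \<ge> -1 \<and> w * exp w = w * exp w" using assms by simp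
  fix v :: real assume v: "v \<ge> -1 \<and> v * exp v = w * exp w"
  have "v * exp v \<ge> 0" using v assms by simp
  then have "v \<ge> 0" by (simp add: zero_le_mult_iff)
  show "v = w"
  proof (rule linorder_cases[of v w])
    assume "v < w"
    then have "v * exp v < w * exp w"
      using \<open>v \<ge> 0\<close> by (intro mult_strict_mono') auto
    then show ?thesis using v by simp
  next
    assume "w < v"
    then have "w * exp w < v * exp v"
      using assms by (intro mult_strict_mono') auto
    then show ?thesis using v by simp
  qed
qed

lemma
  assumes "y \<ge> 0"
  shows Lambert_W_nonneg: "Lambert_W y \<ge> 0"
    and Lambert_W_eq: "Lambert_W y * exp (Lambert_W y) = y"
proof -
  \<comment> \<open>Intermediate value theorem on \<open>{0..y}\<close>, whose right end works
    because \<open>y \<le> y * exp y\<close>.\<close>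
  have "\<exists>w\<ge>0. w \<le> y \<and> w * exp w = y"
  proof (rule IVT')
    have "y * 1 \<le> y * exp y" using assms by (intro mult_left_mono) auto
    then show "y \<le> y * exp y" by simp
  qed (use assms in \<open>auto intro!: continuous_intros\<close>)
  then obtain w where "w \<ge> 0" "w * exp w = y" by blast
  with Lambert_W_mult_exp[of w]
  show "Lambert_W y \<ge> 0" "Lambert_W y * exp (Lambert_W y) = y" by auto
qed

lemma Lambert_W_le:
  assumes "y \<ge> 0"
  shows "Lambert_W y \<le> y"
proof -
  have "Lambert_W y * 1 \<le> Lambert_W y * exp (Lambert_W y)"
    using Lambert_W_nonneg[OF assms] by (intro mult_left_mono) auto
  then show ?thesis using Lambert_W_eq[OF assms] by simp
qed

lemma Lambert_W_mono:
  assumes "0 \<le> y" "y \<le> z"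
  shows "Lambert_W y \<le> Lambert_W z"
proof (rule ccontr)
  assume "\<not> ?thesis"
  then have "Lambert_W z * exp (Lambert_W z) < Lambert_W y * exp (Lambert_W y)"
    using assms Lambert_W_nonneg[of z] by (intro mult_strict_mono') auto
  then show False using assms Lambert_W_eq[of y] Lambert_W_eq[of z] by simp
qed

lemma Lambert_W_pos:
  assumes "y > 0"
  shows "Lambert_W y > 0"
proof -
  have "Lambert_W y \<noteq> 0" using Lambert_W_eq[of y] assms by auto
  then show ?thesis using Lambert_W_nonneg[of y] assms by simp
qed

text \<open>A quotient-free form from which sign and growth can be read off. It also covers
  \<open>x = 0\<close>, where \<open>ln 1 = 0\<close> reproduces the prescribed value.\<close>

lemma g_fun_eq:
  assumes "\<sigma> > 1"
  shows "g_fun \<sigma> x = ln (1 + \<bar>x\<bar>) * exp (Lambert_W (ln (1 + \<bar>x\<bar>)) / (\<sigma> - 1))"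
proof (cases "x = 0")
  case False
  define y where "y = ln (1 + \<bar>x\<bar>)"
  define w where "w = Lambert_W y"
  have y: "y > 0" using False by (simp add: y_def)
  have w: "w > 0" "w * exp w = y"
    using Lambert_W_pos[OF y] Lambert_W_eq[of y] y by (auto simp: w_def)
  have "\<sigma> / (\<sigma> - 1) = 1 + 1 / (\<sigma> - 1)"
    using assms by (simp add: field_simps)
  then have "g_fun \<sigma> x = y * y powr (1 / (\<sigma> - 1)) / w powr (1 / (\<sigma> - 1))"
    using False y by (simp add: g_fun_def powr_add flip: y_def w_def)
  also have "y powr (1 / (\<sigma> - 1)) = w powr (1 / (\<sigma> - 1)) * exp (w / (\<sigma> - 1))"
    unfolding w(2)[symmetric] using w(1) by (simp add: powr_def ln_mult add_divide_distrib exp_add)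
  finally show ?thesis using w by (simp flip: y_def w_def)
qed (simp add: g_fun_def)

lemma g_fun_nonneg: "\<sigma> > 1 \<Longrightarrow> g_fun \<sigma> x \<ge> 0"
  by (simp add: g_fun_eq)

section \<open>First inclusion: comparison of the two weights\<close>

lemma N_class_subset_E_Gamma:
  assumes "\<sigma> > 1"
  shows "N_class \<sigma> \<subseteq> E_Gamma \<sigma>"
proof
  fix f assume "f \<in> N_class \<sigma>"
  then obtain \<phi> \<rho> C where f: "square_integrable f" "is_L2_fourier f \<phi>"
    and cont: "continuous_on UNIV \<phi>" and pos: "\<rho> > 0" "C > 0"
    and C: "\<And>\<xi>. \<bar>\<xi>\<bar> \<ge> 1 \<Longrightarrow>
          exp (\<rho> * ln \<bar>\<xi>\<bar> powr (\<sigma> / (\<sigma> - 1))) * cmod (\<phi> \<xi>) \<le> C"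
    unfolding N_class_def by blast
  define s where "s = \<sigma> / (\<sigma> - 1)"
  define b where "b = 1 / (\<sigma> - 1)"
  have sb: "s > 0" "b > 0" using assms by (auto simp: s_def b_def)
  \<comment> \<open>For \<open>\<bar>x\<bar> \<ge> 2\<close> one has
    \<open>ln (1 + \<bar>x\<bar>) \<ge> ln 3\<close>, so by monotonicity \<open>w0\<close> bounds
    the Lambert factor from below there.\<close>
  define w0 where "w0 = Lambert_W (ln 3)"
  have w0: "w0 > 0" unfolding w0_def by (intro Lambert_W_pos) simp
  \<comment> \<open>Comparison constant for \<open>\<bar>x\<bar> \<ge> 2\<close>; the factor
    \<open>2 powr s\<close> stems from \<open>1 + \<bar>x\<bar> \<le> \<bar>x\<bar>^2\<close>, that
    is \<open>y \<le> 2 * L\<close>.\<close>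
  define K where "K = 2 powr s / w0 powr b"
  have K: "K > 0" using w0 by (simp add: K_def)
  \<comment> \<open>An upper bound of the weight on \<open>{-2..2}\<close>, obtained from
    \<open>Lambert_W y \<le> y \<le> ln 3\<close>.\<close>
  define G where "G = ln 3 * exp (ln 3 / (\<sigma> - 1))"
  have "bounded (\<phi> ` {-2..2})"
    by (intro compact_imp_bounded compact_continuous_image continuous_on_subset[OF cont]) auto
  then obtain B where B: "B > 0" "\<And>x. \<bar>x\<bar> \<le> 2 \<Longrightarrow> cmod (\<phi> x) \<le> B"
    unfolding bounded_pos by (auto simp: abs_le_iff)
  \<comment> \<open>Dividing the rate by \<open>K\<close> makes \<open>r * g_fun \<sigma> x\<close>
    at most \<open>\<rho> * L powr s\<close>.\<close>
  define r where "r = \<rho> / K"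
  have r: "r > 0" using K pos by (simp add: r_def)
  have far: "cmod (\<phi> x) \<le> C * exp (- r * g_fun \<sigma> x)" if x: "\<bar>x\<bar> \<ge> 2" for x
  proof -
    define L where "L = ln \<bar>x\<bar>"
    define y where "y = ln (1 + \<bar>x\<bar>)"
    have "1 + \<bar>x\<bar> \<le> \<bar>x\<bar>^2" using mult_mono[of 2 "\<bar>x\<bar>" "\<bar>x\<bar>" "\<bar>x\<bar>"] x unfolding power2_eq_square by simp
    then have "y \<le> ln (\<bar>x\<bar>^2)" unfolding y_def using x by (subst ln_le_cancel_iff) auto
    then have yL: "y \<le> 2 * L" using x by (simp only: L_def ln_realpow of_nat_numeral)
    have y3: "ln 3 \<le> y" using x unfolding y_def by (subst ln_le_cancel_iff) auto
    have y0: "y > 0" by (rule less_le_trans[OF _ y3]) simp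
    have "w0 \<le> Lambert_W y" unfolding w0_def using y3 by (intro Lambert_W_mono) auto
    have "g_fun \<sigma> x = y powr s / Lambert_W y powr b"
      using x by (auto simp: g_fun_def s_def b_def y_def)
    also have "\<dots> \<le> (2 * L) powr s / w0 powr b"
      using yL y0 w0 sb \<open>w0 \<le> Lambert_W y\<close> by (intro frac_le powr_mono2) auto
    also have "\<dots> = K * L powr s"
      using yL y0 by (simp add: K_def powr_mult)
    finally have "r * g_fun \<sigma> x \<le> r * (K * L powr s)" using r by (intro mult_left_mono) auto
    also have "\<dots> = \<rho> * L powr s" using K by (simp add: r_def)
    finally have g: "r * g_fun \<sigma> x \<le> \<rho> * L powr s" .
    have "cmod (\<phi> x) \<le> C * exp (- (\<rho> * L powr s))"
      using C[of x] x by (simp add: exp_minus field_simps L_def s_def)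
    also have "\<dots> \<le> C * exp (- r * g_fun \<sigma> x)" using g pos by simp
    finally show ?thesis .
  qed
  \<comment> \<open>On the compact interval \<phi> is bounded by \<open>B\<close>, and
    \<open>exp (r * G)\<close> compensates the smallest value of the exponential.\<close>
  have near: "cmod (\<phi> x) \<le> B * exp (r * G) * exp (- r * g_fun \<sigma> x)" if x: "\<bar>x\<bar> \<le> 2" for x
  proof -
    define y where "y = ln (1 + \<bar>x\<bar>)"
    have y: "0 \<le> y" "y \<le> ln 3" using x by (auto simp: y_def)
    have "g_fun \<sigma> x \<le> G" unfolding g_fun_eq[OF assms] G_def y_def[symmetric]
      using y Lambert_W_le[of y] assms by (intro mult_mono) (auto simp: divide_right_mono)
    then have "B * 1 \<le> B * exp (r * G - r * g_fun \<sigma> x)"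
      using B(1) r by (intro mult_left_mono) auto
    moreover have "B * exp (r * G - r * g_fun \<sigma> x) = B * exp (r * G) * exp (- r * g_fun \<sigma> x)"
      by (simp add: exp_diff exp_minus field_simps)
    ultimately show ?thesis using B(2)[OF x] by linarith
  qed
  have "cmod (\<phi> x) \<le> max C (B * exp (r * G)) * exp (- r * g_fun \<sigma> x)" for x
  proof (cases "\<bar>x\<bar> \<ge> 2")
    case True
    have "C * exp (- r * g_fun \<sigma> x) \<le> max C (B * exp (r * G)) * exp (- r * g_fun \<sigma> x)"
      by (intro mult_right_mono) auto
    with far[OF True] show ?thesis by linarith
  next
    case False
    have "B * exp (r * G) * exp (- r * g_fun \<sigma> x)
        \<le> max C (B * exp (r * G)) * exp (- r * g_fun \<sigma> x)"
      by (intro mult_right_mono) auto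
    with near[of x] False show ?thesis by linarith
  qed
  then have "\<phi> \<in> Gamma_class \<sigma>"
    unfolding Gamma_class_def mem_Collect_eq using cont r pos
    by (intro conjI exI[of _ r] exI[of _ "max C (B * exp (r * G))"] allI) auto
  then show "f \<in> E_Gamma \<sigma>" using f unfolding E_Gamma_def by blast
qed

section \<open>Moment bounds for functions in \<open>Gamma_class\<close>\<close>

text \<open>With \<open>y = ln (1 + \<bar>x\<bar>)\<close> and \<open>w = W y\<close> the exponent is \<open>y * (q - \<rho> * exp (w / (\<sigma> - 1)))\<close>. It is
  positive only if \<open>exp w < (q / \<rho>) powr (\<sigma> - 1)\<close>, and then \<open>y = w * exp w\<close> is bounded as well.\<close>

lemma power_g_fun_bound:
  assumes "\<sigma> > 1" "0 < \<rho>" "\<rho> \<le> 1" "q \<ge> 1"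
  shows "(1 + \<bar>x\<bar>) powr q * exp (- \<rho> * g_fun \<sigma> x)
    \<le> exp ((\<sigma> - 1) * \<rho> powr (1 - \<sigma>) * q powr \<sigma> * ln (q / \<rho>))"
proof -
  define y where "y = ln (1 + \<bar>x\<bar>)"
  define w where "w = Lambert_W y"
  have y: "y \<ge> 0" by (simp add: y_def)
  have w: "w \<ge> 0" "w * exp w = y"
    using Lambert_W_nonneg[OF y] Lambert_W_eq[OF y] by (auto simp: w_def)
  define L where "L = ln (q / \<rho>)"
  \<comment> \<open>From \<open>\<rho> \<le> 1 \<le> q\<close> the logarithm \<open>L\<close> is
    nonnegative, so \<open>?R\<close> also dominates a nonpositive exponent.\<close>
  have q\<rho>: "q / \<rho> \<ge> 1" using assms by (simp add: field_simps)
  then have L: "L \<ge> 0" by (simp add: L_def)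
  let ?R = "(\<sigma> - 1) * \<rho> powr (1 - \<sigma>) * q powr \<sigma> * L"
  have "q * y - \<rho> * (y * exp (w / (\<sigma> - 1))) \<le> ?R"
  proof (cases "exp (w / (\<sigma> - 1)) \<ge> q / \<rho>")
    case True
    then have "q \<le> \<rho> * exp (w / (\<sigma> - 1))" using assms by (simp add: field_simps)
    then have "q * y \<le> (\<rho> * exp (w / (\<sigma> - 1))) * y" using y by (intro mult_right_mono)
    then have "q * y - \<rho> * (y * exp (w / (\<sigma> - 1))) \<le> 0" by (simp add: algebra_simps)
    also have "0 \<le> ?R" using assms L by simp
    finally show ?thesis .
  next
    case False
    then have "w / (\<sigma> - 1) \<le> L" unfolding L_def using q\<rho> by (subst ln_ge_iff) auto
    then have wL: "w \<le> (\<sigma> - 1) * L" using assms by (simp add: field_simps)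
    then have "exp w \<le> exp ((\<sigma> - 1) * L)" by simp
    also have "\<dots> = (q / \<rho>) powr (\<sigma> - 1)" using assms by (simp add: L_def powr_def)
    finally have "y \<le> ((\<sigma> - 1) * L) * (q / \<rho>) powr (\<sigma> - 1)"
      unfolding w(2)[symmetric] using wL w by (intro mult_mono) auto
    then have "q * y \<le> q * (((\<sigma> - 1) * L) * (q / \<rho>) powr (\<sigma> - 1))"
      using assms by (intro mult_left_mono) auto
    also have "(q / \<rho>) powr (\<sigma> - 1) = \<rho> powr (1 - \<sigma>) * q powr (\<sigma> - 1)"
      using assms by (simp add: powr_divide powr_diff field_simps)
    also have "q * ((\<sigma> - 1) * L * (\<rho> powr (1 - \<sigma>) * q powr (\<sigma> - 1))) = ?R"
      using assms powr_mult_base[of q "\<sigma> - 1"] by (simp add: mult_ac)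
    finally have "q * y \<le> ?R" .
    moreover have "0 \<le> \<rho> * (y * exp (w / (\<sigma> - 1)))" using assms y by simp
    ultimately show ?thesis by linarith
  qed
  moreover have "(1 + \<bar>x\<bar>) powr q * exp (- \<rho> * g_fun \<sigma> x)
      = exp (q * y - \<rho> * (y * exp (w / (\<sigma> - 1))))"
    by (simp add: powr_def g_fun_eq[OF assms(1)] y_def w_def exp_add[symmetric])
  ultimately show ?thesis by (simp add: L_def)
qed

text \<open>Take \<open>q = p + 2\<close> in \<open>power_g_fun_bound\<close>: up to constants
  \<open>q powr \<sigma> * ln q\<close> is the logarithm of \<open>M_seq\<close>. The two powers
  beyond \<open>p\<close> will make the moments integrable.\<close>

lemma Gamma_class_moment_bound:
  assumes "\<sigma> > 1" "\<phi> \<in> Gamma_class \<sigma>"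
  obtains C \<tau> where "C \<ge> 1" "\<tau> > 0"
    "\<And>p x. (1 + \<bar>x\<bar>) ^ (p + 2) * cmod (\<phi> x) \<le> C powr (real p powr \<sigma> + 1) * M_seq \<tau> \<sigma> p"
proof -
  from assms(2) obtain \<rho>' C' where \<rho>': "\<rho>' > 0" "C' > 0"
    and C': "\<And>x. cmod (\<phi> x) \<le> C' * exp (- \<rho>' * g_fun \<sigma> x)"
    unfolding Gamma_class_def by blast
  \<comment> \<open>Since the weight is nonnegative, a smaller rate gives a weaker bound;
    \<open>power_g_fun_bound\<close> asks for a rate of at most 1.\<close>
  define \<rho> where "\<rho> = min \<rho>' 1"
  have \<rho>: "\<rho> > 0" "\<rho> \<le> 1" "\<rho> \<le> \<rho>'" using \<rho>' by (auto simp: \<rho>_def)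
  define S where "S = (\<sigma> - 1) * \<rho> powr (1 - \<sigma>)"
  have S: "S > 0" using assms \<rho> by (simp add: S_def)
  \<comment> \<open>The factor \<open>3 powr \<sigma>\<close> pays for
    \<open>p + 2 \<le> 3 * p\<close>, valid for \<open>p \<ge> 1\<close>.\<close>
  define \<tau> where "\<tau> = S * 3 powr \<sigma>"
  have \<tau>: "\<tau> > 0" using S by (simp add: \<tau>_def)
  \<comment> \<open>Three factors, each at least 1: the original constant, the bound for
    \<open>p = 0\<close>, and the base of the geometric part for \<open>p \<ge> 1\<close>.\<close>
  define C where "C = max 1 C' * exp (S * 2 powr \<sigma> * ln (2 / \<rho>)) * (3 / \<rho>) powr \<tau>"
  have 1: "1 \<le> max 1 C'" "1 \<le> exp (S * 2 powr \<sigma> * ln (2 / \<rho>))" "1 \<le> (3 / \<rho>) powr \<tau>"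
    using S \<rho> \<tau> by (auto intro!: ge_one_powr_ge_zero)
  have Ca: "max 1 C' \<le> C"
  proof -
    have "max 1 C' * 1 * 1 \<le> C" unfolding C_def using 1 by (intro mult_mono) auto
    then show ?thesis by simp
  qed
  then have C1: "C \<ge> 1" by simp
  have "(1 + \<bar>x\<bar>) ^ (p + 2) * cmod (\<phi> x) \<le> C powr (real p powr \<sigma> + 1) * M_seq \<tau> \<sigma> p" for p x
  proof -
    have "(1 + \<bar>x\<bar>) ^ (p + 2) * cmod (\<phi> x)
        \<le> (1 + \<bar>x\<bar>) powr real (p + 2) * (max 1 C' * exp (- \<rho> * g_fun \<sigma> x))"
    proof (intro mult_mono order.trans[OF C'])
      show "exp (- \<rho>' * g_fun \<sigma> x) \<le> exp (- \<rho> * g_fun \<sigma> x)"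
        using \<rho> g_fun_nonneg[OF assms(1)] by (simp add: mult_right_mono)
    qed (use powr_realpow[of "1 + \<bar>x\<bar>" "p + 2"] in auto)
    also have "\<dots> = max 1 C' * ((1 + \<bar>x\<bar>) powr real (p + 2) * exp (- \<rho> * g_fun \<sigma> x))" by simp
    also have "\<dots> \<le> max 1 C' * exp (S * real (p + 2) powr \<sigma> * ln (real (p + 2) / \<rho>))"
      unfolding S_def using assms \<rho> by (intro mult_left_mono power_g_fun_bound) auto
    also have "\<dots> \<le> C powr (real p powr \<sigma> + 1) * M_seq \<tau> \<sigma> p"
    \<comment> \<open>For \<open>p = 0\<close> the estimate \<open>p + 2 \<le> 3 * p\<close> fails;
      there \<open>0 powr \<sigma> = 0\<close> and \<open>M_seq\<close> is 1, so the target is just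
      \<open>C\<close>.\<close>
    proof (cases "p = 0")
      case True
      have "max 1 C' * exp (S * 2 powr \<sigma> * ln (2 / \<rho>)) * 1 \<le> C"
        unfolding C_def using 1 by (intro mult_left_mono) auto
      then show ?thesis using True C1 by (simp add: M_seq_def)
    next
      case False
      have "S * real (p + 2) powr \<sigma> * ln (real (p + 2) / \<rho>)
          \<le> S * (3 * real p) powr \<sigma> * ln (3 * real p / \<rho>)"
        using False S \<rho> assms
        by (intro mult_mono powr_mono2 mult_nonneg_nonneg) (auto intro!: divide_right_mono ln_ge_zero simp: field_simps)
      \<comment> \<open>The first summand goes into a power with exponent
        \<open>p powr \<sigma>\<close>, the second is exactly the logarithm of
        \<open>M_seq\<close>.\<close>
      also have "\<dots> = \<tau> * real p powr \<sigma> * ln (3 / \<rho>) + \<tau> * real p powr \<sigma> * ln (real p)"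
        using False \<rho> by (simp add: \<tau>_def powr_mult ln_mult ln_div algebra_simps)
      finally have "exp (S * real (p + 2) powr \<sigma> * ln (real (p + 2) / \<rho>))
        \<le> exp (\<tau> * real p powr \<sigma> * ln (3 / \<rho>)) * exp (\<tau> * real p powr \<sigma> * ln (real p))"
        by (simp add: exp_add[symmetric])
      also have "exp (\<tau> * real p powr \<sigma> * ln (real p)) = M_seq \<tau> \<sigma> p"
        using False by (simp add: M_seq_def powr_def)
      also have "exp (\<tau> * real p powr \<sigma> * ln (3 / \<rho>)) = ((3 / \<rho>) powr \<tau>) powr (real p powr \<sigma>)"
        using \<rho> unfolding powr_powr by (simp add: powr_def)
      finally have "max 1 C' * exp (S * real (p + 2) powr \<sigma> * ln (real (p + 2) / \<rho>))
        \<le> max 1 C' * (((3 / \<rho>) powr \<tau>) powr (real p powr \<sigma>) * M_seq \<tau> \<sigma> p)"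
        by (intro mult_left_mono) auto
      also have "\<dots> \<le> C * (C powr (real p powr \<sigma>) * M_seq \<tau> \<sigma> p)"
      proof (intro mult_mono powr_mono2)
        have "(3 / \<rho>) powr \<tau> = 1 * 1 * (3 / \<rho>) powr \<tau>" by simp
        also have "\<dots> \<le> C" unfolding C_def using 1 by (intro mult_mono) auto
        finally show "(3 / \<rho>) powr \<tau> \<le> C" .
      qed (use Ca C1 in \<open>auto simp: M_seq_def\<close>)
      finally show ?thesis using C1 by (simp add: powr_add mult_ac)
    qed
    finally show ?thesis .
  qed
  with C1 \<tau> show thesis by (rule that)
qed

subsection \<open>Fourier inversion\<close>

lemma borel_measurable_cis [measurable]: "cis \<in> borel_measurable borel"
  by (intro borel_measurable_continuous_onI continuous_intros)

lemma integrable_mult_cis: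
  fixes f :: "real \<Rightarrow> complex"
  assumes "integrable lborel f" and [measurable]: "h \<in> borel_measurable borel"
  shows "integrable lborel (\<lambda>x. f x * cis (h x))"
proof (rule Bochner_Integration.integrable_bound[OF assms(1)])
  have [measurable]: "f \<in> borel_measurable borel" using assms(1) by auto
  show "(\<lambda>x. f x * cis (h x)) \<in> borel_measurable lborel" by measurable
qed (simp add: norm_mult)

text \<open>Fubini applies because the kernel has modulus 1, so the integrand is dominated by a
  product of integrable functions. The parameter \<open>c\<close> admits both signs of the
  kernel.\<close>

lemma fourier_multiplication:
  fixes f g :: "real \<Rightarrow> complex"
  assumes "integrable lborel f" "integrable lborel g"
  shows "(LINT x|lborel. f x * (LINT y|lborel. g y * cis (c * x * y)))
       = (LINT y|lborel. g y * (LINT x|lborel. f x * cis (c * x * y)))"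
proof -
  have [measurable]: "f \<in> borel_measurable borel" "g \<in> borel_measurable borel"
    using assms by auto
  let ?h = "\<lambda>x y. f x * g y * cis (c * x * y)"
  have "integrable (lborel \<Otimes>\<^sub>M lborel) (case_prod ?h)"
  proof (rule lborel_pair.Fubini_integrable)
    have "integrable lborel (\<lambda>x. cmod (f x) * (LINT y|lborel. cmod (g y)))"
      using assms by (intro integrable_mult_left integrable_norm) auto
    then show "integrable lborel (\<lambda>x. LINT y|lborel. cmod (case (x, y) of (x, y) \<Rightarrow> ?h x y))"
      by (simp add: norm_mult)
    have "integrable lborel (\<lambda>y. ?h x y)" for x
      using assms by (intro integrable_mult_cis integrable_mult_right) auto
    then show "AE x in lborel. integrable lborel (\<lambda>y. case (x, y) of (x, y) \<Rightarrow> ?h x y)" by simp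
  qed measurable
  from lborel_pair.Fubini_integral[OF this]
  have "(LINT y|lborel. LINT x|lborel. ?h x y) = (LINT x|lborel. LINT y|lborel. ?h x y)" .
  moreover have "(LINT y|lborel. ?h x y) = f x * (LINT y|lborel. g y * cis (c * x * y))" for x
    by (simp only: mult.assoc integral_mult_right_zero)
  moreover have "(LINT x|lborel. ?h x y) = g y * (LINT x|lborel. f x * cis (c * x * y))" for y
    by (simp only: mult.assoc mult.left_commute[of _ "g y"] integral_mult_right_zero)
  ultimately show ?thesis by simp
qed

text \<open>This is the characteristic function \<open>exp (- t\<^sup>2 / 2)\<close> of the standard
  normal distribution, rewritten as a multiple of its density.\<close>

lemma fourier_gauss:
  "(LINT x|lborel. complex_of_real (std_normal_density x) * cis (t * x))
     = complex_of_real (sqrt (2 * pi) * std_normal_density t)"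
proof -
  have "char std_normal_distribution t
      = (LINT x|lborel. std_normal_density x *\<^sub>R iexp (t * x))"
    unfolding char_def by (subst integral_density) auto
  also have "\<dots> = (LINT x|lborel. complex_of_real (std_normal_density x) * cis (t * x))"
    by (simp only: cis_conv_exp scaleR_conv_of_real)
  finally have "(LINT x|lborel. complex_of_real (std_normal_density x) * cis (t * x))
      = complex_of_real (exp (- t\<^sup>2 / 2))"
    unfolding char_std_normal_distribution by simp
  then show ?thesis by (simp add: std_normal_density_def)
qed

lemma integrable_gauss: "integrable lborel (\<lambda>x. complex_of_real (std_normal_density x))"
  using integrable_std_normal_moment[of 0] by (intro integrable_of_real) simp

text \<open>Substitute \<open>\<xi> = s + v / (2 * pi)\<close>: the scaling absorbs the
  \<open>2 * pi\<close> of the kernel, and the shift by \<open>s\<close> turns into a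
  modulation.\<close>

lemma fourier_gauss_affine:
  "(LINT \<xi>|lborel. complex_of_real (std_normal_density (2 * pi * (\<xi> - s))) * cis (- 2 * pi * x * \<xi>))
     = cis (- 2 * pi * x * s) * complex_of_real (std_normal_density x / sqrt (2 * pi))"
proof -
  have "(LINT \<xi>|lborel. complex_of_real (std_normal_density (2 * pi * (\<xi> - s))) * cis (- 2 * pi * x * \<xi>))
    = \<bar>1 / (2 * pi)\<bar> *\<^sub>R (LINT v|lborel. complex_of_real (std_normal_density (2 * pi * ((s + 1 / (2 * pi) * v) - s)))
        * cis (- 2 * pi * x * (s + 1 / (2 * pi) * v)))"
    by (rule lborel_integral_real_affine) simp
  also have "(\<lambda>v. complex_of_real (std_normal_density (2 * pi * ((s + 1 / (2 * pi) * v) - s)))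
        * cis (- 2 * pi * x * (s + 1 / (2 * pi) * v)))
    = (\<lambda>v. cis (- 2 * pi * x * s) * (complex_of_real (std_normal_density v) * cis (- x * v)))"
  proof
    fix v
    have "- 2 * pi * x * (s + 1 / (2 * pi) * v) = - 2 * pi * x * s + - x * v"
      by (simp add: field_simps)
    then have "cis (- 2 * pi * x * (s + 1 / (2 * pi) * v)) = cis (- 2 * pi * x * s) * cis (- x * v)"
      by (simp only: cis_mult)
    then show "complex_of_real (std_normal_density (2 * pi * ((s + 1 / (2 * pi) * v) - s)))
        * cis (- 2 * pi * x * (s + 1 / (2 * pi) * v))
      = cis (- 2 * pi * x * s) * (complex_of_real (std_normal_density v) * cis (- x * v))"
      by (simp add: mult_ac)
  qed
  also have "(LINT v|lborel. cis (- 2 * pi * x * s) * (complex_of_real (std_normal_density v) * cis (- x * v)))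
    = cis (- 2 * pi * x * s) * complex_of_real (sqrt (2 * pi) * std_normal_density x)"
    by (simp only: integral_mult_right_zero fourier_gauss) (simp add: std_normal_density_def)
  also have "\<bar>1 / (2 * pi)\<bar> *\<^sub>R (cis (- 2 * pi * x * s) * complex_of_real (sqrt (2 * pi) * std_normal_density x))
    = cis (- 2 * pi * x * s) * complex_of_real ((1 / (2 * pi)) * sqrt (2 * pi) * std_normal_density x)"
    by (simp add: scaleR_conv_of_real)
  also have "(1 / (2 * pi)) * sqrt (2 * pi) = 1 / sqrt (2 * pi)"
    by (simp add: field_simps flip: real_sqrt_mult)
  finally show ?thesis by simp
qed

lemma integrable_shifted_gauss:
  "integrable lborel (\<lambda>\<xi>. complex_of_real (std_normal_density (2 * pi * (\<xi> - s))))"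
  using lborel_integrable_real_affine[OF integrable_gauss, of "2 * pi" "- (2 * pi * s)"]
  by (simp add: algebra_simps)

section \<open>Uniqueness of the Fourier transform of integrable functions\<close>

text \<open>The positive and the negative part have the same Fourier transform, hence the same mass. After
  normalisation they are densities of probability measures with equal characteristic functions.\<close>

lemma AE_zero_of_real_fourier_zero:
  fixes r :: "real \<Rightarrow> real"
  assumes r: "integrable lborel r"
    and zero: "\<And>t. (LINT x|lborel. complex_of_real (r x) * cis (t * x)) = 0"
  shows "AE x in lborel. r x = 0"
proof -
  have [measurable]: "r \<in> borel_measurable borel" using r by auto
  define P where "P = (\<lambda>x. max 0 (r x))"
  define N where "N = (\<lambda>x. max 0 (- r x))"
  have PN: "r x = P x - N x" "P x \<ge> 0" "N x \<ge> 0" for x by (auto simp: P_def N_def)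
  have int: "integrable lborel P" "integrable lborel N" using r by (auto simp: P_def N_def)
  have [measurable]: "P \<in> borel_measurable borel" "N \<in> borel_measurable borel"
    unfolding P_def N_def by measurable
  have eq: "(LINT x|lborel. complex_of_real (P x) * cis (t * x))
      = (LINT x|lborel. complex_of_real (N x) * cis (t * x))" for t
  proof -
    have "integrable lborel (\<lambda>x. complex_of_real (P x) * cis (t * x))"
      "integrable lborel (\<lambda>x. complex_of_real (N x) * cis (t * x))"
      using int by (auto intro!: integrable_mult_cis integrable_of_real)
    from Bochner_Integration.integral_diff[OF this] zero[of t] show ?thesis
      by (simp add: PN(1) left_diff_distrib)
  qed
  define c where "c = (LINT x|lborel. P x)"
  have cN: "c = (LINT x|lborel. N x)" using eq[of 0] by (simp add: c_def)
  show ?thesis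
  \<comment> \<open>With zero mass there is nothing to normalise: both nonnegative parts vanish
    almost everywhere.\<close>
  proof (cases "c = 0")
    case True
    have "AE x in lborel. P x = 0" "AE x in lborel. N x = 0"
      using integral_nonneg_eq_0_iff_AE[OF int(1)] integral_nonneg_eq_0_iff_AE[OF int(2)]
        True cN PN by (auto simp: c_def)
    then show ?thesis by eventually_elim (simp add: PN(1))
  next
    case False
    have "c \<ge> 0" unfolding c_def by (intro Bochner_Integration.integral_nonneg PN)
    with False have c: "c > 0" by simp
    \<comment> \<open>Stated for a generic \<open>Q\<close> of mass \<open>c\<close>, so that it
      serves \<open>P\<close> and \<open>N\<close> alike.\<close>
    have dist: "real_distribution (density lborel (\<lambda>x. ennreal (Q x / c)))"
      and char: "char (density lborel (\<lambda>x. ennreal (Q x / c)))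
        = (\<lambda>t. (LINT x|lborel. complex_of_real (Q x) * cis (t * x)) / c)"
      if Q: "integrable lborel Q" "\<And>x. Q x \<ge> 0" "(LINT x|lborel. Q x) = c" for Q :: "real \<Rightarrow> real"
    proof -
      have [measurable]: "Q \<in> borel_measurable borel" using Q(1) by auto
      have "(\<integral>\<^sup>+x. ennreal (Q x / c) \<partial>lborel) = ennreal (LINT x|lborel. Q x / c)"
        using Q c by (intro nn_integral_eq_integral) auto
      also have "\<dots> = 1" using Q c by simp
      finally have "prob_space (density lborel (\<lambda>x. ennreal (Q x / c)))"
        by (intro prob_spaceI) (simp add: emeasure_density)
      then show "real_distribution (density lborel (\<lambda>x. ennreal (Q x / c)))"
        by (simp add: real_distribution_def real_distribution_axioms_def)
      show "char (density lborel (\<lambda>x. ennreal (Q x / c)))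
        = (\<lambda>t. (LINT x|lborel. complex_of_real (Q x) * cis (t * x)) / c)"
      proof
        fix t
        have "char (density lborel (\<lambda>x. ennreal (Q x / c))) t
          = (LINT x|lborel. (Q x / c) *\<^sub>R iexp (t * x))"
          unfolding char_def using Q c by (subst integral_density) auto
        also have "\<dots> = (LINT x|lborel. complex_of_real (Q x) * cis (t * x) / c)"
          by (simp add: cis_conv_exp scaleR_conv_of_real mult_ac)
        finally show "char (density lborel (\<lambda>x. ennreal (Q x / c))) t
          = (LINT x|lborel. complex_of_real (Q x) * cis (t * x)) / c" by simp
      qed
    qed
    have "density lborel (\<lambda>x. ennreal (P x / c)) = density lborel (\<lambda>x. ennreal (N x / c))"
    proof (intro Levy_uniqueness dist)
      show "char (density lborel (\<lambda>x. ennreal (P x / c))) = char (density lborel (\<lambda>x. ennreal (N x / c)))"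
        unfolding char[OF int(1) PN(2) c_def[symmetric]] char[OF int(2) PN(3) cN[symmetric]] eq ..
    qed (use int PN cN in \<open>simp_all add: c_def\<close>)
    \<comment> \<open>Lebesgue measure is \<sigma>-finite, so equal measures have almost everywhere
      equal densities.\<close>
    then have "AE x in lborel. ennreal (P x / c) = ennreal (N x / c)"
      by (subst (asm) sigma_finite_measure.density_unique_iff[OF sigma_finite_lborel]) auto
    then show ?thesis
      by eventually_elim (use c PN in \<open>simp add: ennreal_inj\<close>)
  qed
qed

text \<open>Conjugating the hypothesis at \<open>- t\<close> shows that the transform of
  \<open>cnj m\<close> vanishes too, hence those of the real and imaginary parts, to which the real
  case applies.\<close>

lemma AE_zero_of_fourier_zero:
  fixes m :: "real \<Rightarrow> complex"
  assumes m: "integrable lborel m"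
    and zero: "\<And>t. (LINT x|lborel. m x * cis (t * x)) = 0"
  shows "AE x in lborel. m x = 0"
proof -
  have cnj: "(LINT x|lborel. cnj (m x) * cis (t * x)) = 0" for t
  proof -
    have "(LINT x|lborel. cnj (m x) * cis (t * x)) = (LINT x|lborel. cnj (m x * cis (- t * x)))"
      by (simp add: cis_cnj)
    also have "\<dots> = 0"
      using zero[of "- t"] by (simp only: Bochner_Integration.integral_cnj) simp
    finally show ?thesis .
  qed
  have int: "integrable lborel (\<lambda>x. m x * cis (t * x))"
    "integrable lborel (\<lambda>x. cnj (m x) * cis (t * x))" for t
    using m by (auto intro!: integrable_mult_cis)
  have re: "complex_of_real (Re z) = (z + cnj z) / 2"
    and im: "complex_of_real (Im z) = (z - cnj z) * (- \<i> / 2)" for z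
    by (auto simp: complex_eq_iff)
  have "AE x in lborel. Re (m x) = 0"
  proof (rule AE_zero_of_real_fourier_zero)
    show "(LINT x|lborel. complex_of_real (Re (m x)) * cis (t * x)) = 0" for t
    proof -
      have "(\<lambda>x. complex_of_real (Re (m x)) * cis (t * x))
          = (\<lambda>x. (1 / 2) * (m x * cis (t * x) + cnj (m x) * cis (t * x)))"
        by (simp add: re algebra_simps add_divide_distrib)
      then show ?thesis
        using Bochner_Integration.integral_add[OF int(1,2)[of t]] zero[of t] cnj[of t]
        by (simp only: integral_mult_right_zero) simp
    qed
  qed (use m in simp)
  moreover have "AE x in lborel. Im (m x) = 0"
  proof (rule AE_zero_of_real_fourier_zero)
    show "(LINT x|lborel. complex_of_real (Im (m x)) * cis (t * x)) = 0" for t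
    proof -
      have "(\<lambda>x. complex_of_real (Im (m x)) * cis (t * x))
          = (\<lambda>x. (- \<i> / 2) * (m x * cis (t * x) - cnj (m x) * cis (t * x)))"
        by (simp add: im algebra_simps)
      then show ?thesis
        using Bochner_Integration.integral_diff[OF int(1,2)[of t]] zero[of t] cnj[of t]
        by (simp only: integral_mult_right_zero) simp
    qed
  qed (use m in simp)
  ultimately show ?thesis by eventually_elim (simp add: complex_eq_iff)
qed

section \<open>Integrability on intervals and against the Gaussian\<close>

text \<open>By \<open>a \<le> 1 + a\<^sup>2\<close> on an interval of finite length; this makes the
  truncated Fourier integrals absolutely convergent.\<close>

lemma square_integrable_imp_set_integrable:
  assumes "square_integrable f"
  shows "set_integrable lborel {a..b} f"
  unfolding set_integrable_def
proof (rule Bochner_Integration.integrable_bound)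
  have [measurable]: "f \<in> borel_measurable borel"
    using assms by (simp add: square_integrable_def)
  have "integrable lborel (\<lambda>x. indicator {a..b} x :: real)"
    using emeasure_bounded_finite[of "{a..b}"] by (simp add: integrable_indicator_iff)
  then show "integrable lborel (\<lambda>x. indicator {a..b} x + (cmod (f x))\<^sup>2)"
    using assms unfolding square_integrable_def by (intro Bochner_Integration.integrable_add) auto
  have "cmod (f x) \<le> 1 + (cmod (f x))\<^sup>2" for x
  proof -
    have "2 * cmod (f x) \<le> 1 + (cmod (f x))\<^sup>2"
      using zero_le_power2[of "cmod (f x) - 1"] unfolding power2_diff by simp
    then show ?thesis using norm_ge_zero[of "f x"] by linarith
  qed
  then show "AE x in lborel. norm (indicator {a..b} x *\<^sub>R f x)
      \<le> norm (indicator {a..b} x + (cmod (f x))\<^sup>2)"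
    by (auto simp: indicator_def abs_of_nonneg)
  show "(\<lambda>x. indicator {a..b} x *\<^sub>R f x) \<in> borel_measurable lborel" by measurable
qed

lemma std_normal_density_le_1: "std_normal_density x \<le> 1"
proof -
  have "1 \<le> sqrt (2 * pi)" using pi_gt3 by simp
  then have "exp (- x\<^sup>2 / 2) \<le> sqrt (2 * pi)" by (smt (verit) exp_le_one_iff zero_le_power2 divide_nonneg_nonneg minus_divide_left)
  then show ?thesis by (simp add: std_normal_density_def)
qed

lemma square_integrable_mult_gauss:
  assumes "square_integrable f"
  shows "integrable lborel (\<lambda>x. f x * complex_of_real (std_normal_density x))"
proof (rule Bochner_Integration.integrable_bound)
  have [measurable]: "f \<in> borel_measurable borel"
    using assms by (simp add: square_integrable_def)
  show "integrable lborel (\<lambda>x. (cmod (f x))\<^sup>2 + std_normal_density x)"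
    using assms integrable_std_normal_moment[of 0] unfolding square_integrable_def by auto
  \<comment> \<open>The second summand dominates where \<open>f\<close> has modulus at most 1;
    elsewhere the first does, since the density is at most 1.\<close>
  have "cmod (f x) * std_normal_density x \<le> (cmod (f x))\<^sup>2 + std_normal_density x" for x
  proof (cases "cmod (f x) \<le> 1")
    case True
    then have "cmod (f x) * std_normal_density x \<le> 1 * std_normal_density x"
      by (intro mult_right_mono) auto
    then show ?thesis using zero_le_power2[of "cmod (f x)"] by linarith
  next
    case False
    have "cmod (f x) * std_normal_density x \<le> cmod (f x) * cmod (f x)"
      using False std_normal_density_le_1[of x] by (intro mult_left_mono) auto
    then show ?thesis using normal_density_nonneg[of 0 1 x] unfolding power2_eq_square by linarith
  qed
  then show "AE x in lborel. norm (f x * complex_of_real (std_normal_density x))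
      \<le> norm ((cmod (f x))\<^sup>2 + std_normal_density x)"
    by (auto simp: norm_mult abs_of_nonneg)
  show "(\<lambda>x. f x * complex_of_real (std_normal_density x)) \<in> borel_measurable lborel"
    by measurable
qed

section \<open>Pairing with translated Gaussians\<close>

text \<open>For integrable \<phi> the integral converges at every point, so it singles out one
  function rather than a class modulo null sets.\<close>

definition inverse_fourier :: "(real \<Rightarrow> complex) \<Rightarrow> real \<Rightarrow> complex" where
  "inverse_fourier \<phi> x = (LINT \<xi>|lborel. \<phi> \<xi> * cis (2 * pi * x * \<xi>))"

text \<open>Fubini moves the transform from \<phi> to the Gaussian, where the modulation by
  \<open>s\<close> becomes a translation.\<close>

lemma inverse_fourier_gauss:
  assumes "integrable lborel \<phi>"
  shows "(LINT x|lborel. inverse_fourier \<phi> x * complex_of_real (std_normal_density x) * cis (- 2 * pi * x * s))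
    = (LINT \<xi>|lborel. \<phi> \<xi> * complex_of_real (sqrt (2 * pi) * std_normal_density (2 * pi * (\<xi> - s))))"
proof -
  have "(LINT x|lborel. (complex_of_real (std_normal_density x) * cis (- 2 * pi * x * s)) *
            (LINT \<xi>|lborel. \<phi> \<xi> * cis (2 * pi * x * \<xi>)))
      = (LINT \<xi>|lborel. \<phi> \<xi> * (LINT x|lborel. (complex_of_real (std_normal_density x)
           * cis (- 2 * pi * x * s)) * cis (2 * pi * x * \<xi>)))"
    by (intro fourier_multiplication integrable_mult_cis integrable_gauss assms) auto
  also have "(\<lambda>\<xi>. LINT x|lborel. (complex_of_real (std_normal_density x)
           * cis (- 2 * pi * x * s)) * cis (2 * pi * x * \<xi>))
     = (\<lambda>\<xi>. LINT x|lborel. complex_of_real (std_normal_density x) * cis ((2 * pi * (\<xi> - s)) * x))"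
    by (simp add: mult.assoc cis_mult) (simp add: algebra_simps)
  finally show ?thesis
    unfolding fourier_gauss by (simp add: inverse_fourier_def mult_ac)
qed

text \<open>The counterpart for \<open>f\<close>: its restriction to \<open>{-R..R}\<close> is
  integrable, so Fubini applies although \<open>f\<close> is only square integrable.\<close>

lemma truncated_fourier_gauss:
  assumes "square_integrable f"
  shows "(LINT \<xi>|lborel. truncated_fourier f R \<xi> * complex_of_real (sqrt (2 * pi) * std_normal_density (2 * pi * (\<xi> - s))))
    = (LINT x|lborel. indicator {-R..R} x *\<^sub>R
        (f x * complex_of_real (std_normal_density x) * cis (- 2 * pi * x * s)))"
proof -
  have "(LINT \<xi>|lborel. complex_of_real (std_normal_density (2 * pi * (\<xi> - s))) *
            (LINT x|lborel. (indicator {-R..R} x *\<^sub>R f x) * cis (- 2 * pi * \<xi> * x)))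
      = (LINT x|lborel. (indicator {-R..R} x *\<^sub>R f x) *
           (LINT \<xi>|lborel. complex_of_real (std_normal_density (2 * pi * (\<xi> - s))) * cis (- 2 * pi * \<xi> * x)))"
    using square_integrable_imp_set_integrable[OF assms]
    by (intro fourier_multiplication integrable_shifted_gauss) (simp add: set_integrable_def)
  also have "\<dots> = (LINT x|lborel. (indicator {-R..R} x *\<^sub>R f x) *
     (cis (- 2 * pi * x * s) * complex_of_real (std_normal_density x / sqrt (2 * pi))))"
    using fourier_gauss_affine[of s] by (simp add: mult_ac)
  finally have eq: "(LINT \<xi>|lborel. complex_of_real (std_normal_density (2 * pi * (\<xi> - s))) *
            (LINT x|lborel. (indicator {-R..R} x *\<^sub>R f x) * cis (- 2 * pi * \<xi> * x)))
     = (LINT x|lborel. (indicator {-R..R} x *\<^sub>R f x) *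
     (cis (- 2 * pi * x * s) * complex_of_real (std_normal_density x / sqrt (2 * pi))))" .
  \<comment> \<open>The factor \<open>sqrt (2 * pi)\<close> cancels the one from
    \<open>fourier_gauss_affine\<close> and agrees with
    \<open>inverse_fourier_gauss\<close>.\<close>
  have "(LINT \<xi>|lborel. truncated_fourier f R \<xi> * complex_of_real (sqrt (2 * pi) * std_normal_density (2 * pi * (\<xi> - s))))
    = (LINT \<xi>|lborel. complex_of_real (sqrt (2 * pi)) * (complex_of_real (std_normal_density (2 * pi * (\<xi> - s))) *
            (LINT x|lborel. (indicator {-R..R} x *\<^sub>R f x) * cis (- 2 * pi * \<xi> * x))))"
    by (simp add: truncated_fourier_def set_lebesgue_integral_def mult_ac)
  also have "\<dots> = (LINT x|lborel. complex_of_real (sqrt (2 * pi)) * ((indicator {-R..R} x *\<^sub>R f x) *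
     (cis (- 2 * pi * x * s) * complex_of_real (std_normal_density x / sqrt (2 * pi)))))"
    by (simp only: integral_mult_right_zero eq)
  also have "\<dots> = (LINT x|lborel. indicator {-R..R} x *\<^sub>R
        (f x * complex_of_real (std_normal_density x) * cis (- 2 * pi * x * s)))"
    by (intro Bochner_Integration.integral_cong) (simp_all add: scaleR_conv_of_real field_simps)
  finally show ?thesis .
qed

section \<open>Passage to the limit and the inversion formula\<close>

lemma borel_measurable_fourier_integral [measurable]:
  fixes f :: "real \<Rightarrow> complex"
  assumes [measurable]: "f \<in> borel_measurable borel"
  shows "(\<lambda>x. LINT y|lborel. f y * cis (c * x * y)) \<in> borel_measurable borel"
  by measurable

lemma norm_fourier_integral_le:
  fixes f :: "real \<Rightarrow> complex"
  shows "cmod (LINT y|lborel. f y * cis (h y)) \<le> (LINT y|lborel. cmod (f y))"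
  using integral_norm_bound[of lborel "\<lambda>y. f y * cis (h y)"] by (simp add: norm_mult)

lemma truncated_fourier_eq:
  "truncated_fourier f R \<xi> =
     (LINT x|lborel. (indicator {-R..R} x *\<^sub>R f x) * cis ((- 2 * pi) * \<xi> * x))"
  by (simp add: truncated_fourier_def set_lebesgue_integral_def mult_ac)

text \<open>By Cauchy-Schwarz, convergence in the square mean implies convergence of pairings with a
  square integrable \<open>h\<close>.\<close>

lemma truncated_fourier_tendsto:
  assumes f: "square_integrable f" and F: "is_L2_fourier f F"
    and h: "integrable lborel h" "square_integrable h"
  shows "((\<lambda>R. LINT \<xi>|lborel. truncated_fourier f R \<xi> * h \<xi>) \<longlongrightarrow> (LINT \<xi>|lborel. F \<xi> * h \<xi>)) at_top"
proof -
  have [measurable]: "f \<in> borel_measurable borel" "F \<in> borel_measurable borel"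
    "h \<in> borel_measurable borel"
    using f F h by (auto simp: square_integrable_def is_L2_fourier_def)
  have [measurable]: "truncated_fourier f R \<in> borel_measurable borel" for R
    unfolding truncated_fourier_eq[abs_def] by measurable
  have F2: "integrable lborel (\<lambda>x. (cmod (F x))\<^sup>2)" and h2: "integrable lborel (\<lambda>x. (cmod (h x))\<^sup>2)"
    using F h by (auto simp: square_integrable_def is_L2_fourier_def)
  have Fh: "integrable lborel (\<lambda>\<xi>. F \<xi> * h \<xi>)"
  proof (rule Bochner_Integration.integrable_bound)
    show "integrable lborel (\<lambda>x. (cmod (F x))\<^sup>2 + (cmod (h x))\<^sup>2)" using F2 h2 by simp
    have "a * b \<le> a\<^sup>2 + b\<^sup>2" if "a \<ge> 0" "b \<ge> 0" for a b :: real
      using sum_squares_bound[of a b] mult_nonneg_nonneg[OF that] by linarith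
    then show "AE x in lborel. norm (F x * h x) \<le> norm ((cmod (F x))\<^sup>2 + (cmod (h x))\<^sup>2)"
      by (auto simp: norm_mult abs_of_nonneg)
  qed measurable
  \<comment> \<open>The truncated transform is bounded by \<open>?B\<close>, so integrability of
    \<open>h\<close> suffices.\<close>
  have Th: "integrable lborel (\<lambda>\<xi>. truncated_fourier f R \<xi> * h \<xi>)" for R
  proof (rule Bochner_Integration.integrable_bound)
    let ?B = "LINT x|lborel. cmod (indicator {-R..R} x *\<^sub>R f x)"
    show "integrable lborel (\<lambda>x. ?B * cmod (h x))" using h(1) by simp
    have "cmod (truncated_fourier f R \<xi>) \<le> ?B" for \<xi>
      unfolding truncated_fourier_eq by (rule norm_fourier_integral_le)
    then have "cmod (truncated_fourier f R \<xi>) * cmod (h \<xi>) \<le> ?B * cmod (h \<xi>)" for \<xi>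
      by (intro mult_right_mono) auto
    then show "AE \<xi> in lborel. norm (truncated_fourier f R \<xi> * h \<xi>) \<le> norm (?B * cmod (h \<xi>))"
      by (auto simp: norm_mult intro!: AE_I2 order.trans[OF _ abs_ge_self])
  qed measurable
  let ?D = "\<lambda>R \<xi>. F \<xi> - truncated_fourier f R \<xi>"
  let ?H = "\<integral>\<^sup>+ \<xi>. ennreal ((cmod (h \<xi>))\<^sup>2) \<partial>lborel"
  \<comment> \<open>Finiteness of \<open>?H\<close> rules out the indeterminate product of 0 and
    infinity in the limit below.\<close>
  have H: "?H < \<infinity>" using h2 by (simp add: nn_integral_eq_integral)
  \<comment> \<open>Cauchy-Schwarz for nonnegative integrals, the form in which
    \<open>is_L2_fourier\<close> expresses convergence.\<close>
  have bound: "ennreal ((cmod (LINT \<xi>|lborel. ?D R \<xi> * h \<xi>))\<^sup>2)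
      \<le> (\<integral>\<^sup>+ \<xi>. ennreal ((cmod (?D R \<xi>))\<^sup>2) \<partial>lborel) * ?H" for R
  proof -
    have "ennreal (cmod (LINT \<xi>|lborel. ?D R \<xi> * h \<xi>)) \<le> (\<integral>\<^sup>+ \<xi>. ennreal (cmod (?D R \<xi> * h \<xi>)) \<partial>lborel)"
      using Fh Th by (intro integral_norm_bound_ennreal) (simp add: left_diff_distrib)
    also have "\<dots> = (\<integral>\<^sup>+ \<xi>. ennreal (cmod (?D R \<xi>)) * ennreal (cmod (h \<xi>)) \<partial>lborel)"
      by (simp add: norm_mult ennreal_mult)
    finally have "(ennreal (cmod (LINT \<xi>|lborel. ?D R \<xi> * h \<xi>)))\<^sup>2
      \<le> (\<integral>\<^sup>+ \<xi>. ennreal (cmod (?D R \<xi>)) * ennreal (cmod (h \<xi>)) \<partial>lborel)\<^sup>2"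
      by (intro power_mono) auto
    also have "\<dots> \<le> (\<integral>\<^sup>+ \<xi>. (ennreal (cmod (?D R \<xi>)))\<^sup>2 \<partial>lborel) * (\<integral>\<^sup>+ \<xi>. (ennreal (cmod (h \<xi>)))\<^sup>2 \<partial>lborel)"
      by (rule Cauchy_Schwarz_nn_integral) measurable
    finally show ?thesis by (simp add: ennreal_power)
  qed
  have "((\<lambda>R. (\<integral>\<^sup>+ \<xi>. ennreal ((cmod (?D R \<xi>))\<^sup>2) \<partial>lborel) * ?H) \<longlongrightarrow> 0 * ?H) at_top"
    using F H by (intro tendsto_mult_ennreal tendsto_const) (auto simp: is_L2_fourier_def)
  then have lim: "((\<lambda>R. (\<integral>\<^sup>+ \<xi>. ennreal ((cmod (?D R \<xi>))\<^sup>2) \<partial>lborel) * ?H) \<longlongrightarrow> 0) at_top"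
    by (simp only: mult_zero_left)
  have "((\<lambda>R. ennreal ((cmod (LINT \<xi>|lborel. ?D R \<xi> * h \<xi>))\<^sup>2)) \<longlongrightarrow> 0) at_top"
    by (rule tendsto_sandwich[OF _ _ tendsto_const lim])
      (intro always_eventually allI bound zero_le)+
  then have "((\<lambda>R. (cmod (LINT \<xi>|lborel. ?D R \<xi> * h \<xi>))\<^sup>2) \<longlongrightarrow> 0) at_top"
    by (subst (asm) ennreal_0[symmetric], subst (asm) tendsto_ennreal_iff) auto
  from tendsto_real_sqrt[OF this] have "((\<lambda>R. LINT \<xi>|lborel. ?D R \<xi> * h \<xi>) \<longlongrightarrow> 0) at_top"
    by (simp add: tendsto_norm_zero_iff)
  then have "((\<lambda>R. (LINT \<xi>|lborel. F \<xi> * h \<xi>) - (LINT \<xi>|lborel. ?D R \<xi> * h \<xi>)) \<longlongrightarrow> (LINT \<xi>|lborel. F \<xi> * h \<xi>) - 0) at_top"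
    by (intro tendsto_intros)
  moreover have "(LINT \<xi>|lborel. F \<xi> * h \<xi>) - (LINT \<xi>|lborel. ?D R \<xi> * h \<xi>)
      = (LINT \<xi>|lborel. truncated_fourier f R \<xi> * h \<xi>)" for R
    using Fh Th[of R] by (simp add: left_diff_distrib)
  ultimately show ?thesis by simp
qed

lemma square_integrable_gauss:
  "square_integrable (\<lambda>\<xi>. complex_of_real (std_normal_density (2 * pi * (\<xi> - s))))"
  unfolding square_integrable_def
proof
  show "integrable lborel (\<lambda>\<xi>. (cmod (complex_of_real (std_normal_density (2 * pi * (\<xi> - s)))))\<^sup>2)"
  proof (rule Bochner_Integration.integrable_bound[OF integrable_shifted_gauss[of s]])
    have "(std_normal_density y)\<^sup>2 \<le> std_normal_density y" for y
      using mult_right_mono[OF std_normal_density_le_1, of "std_normal_density y" y]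
      by (simp add: power2_eq_square)
    then show "AE \<xi> in lborel. norm ((cmod (complex_of_real (std_normal_density (2 * pi * (\<xi> - s)))))\<^sup>2)
      \<le> norm (complex_of_real (std_normal_density (2 * pi * (\<xi> - s))))"
      by (auto simp del: power2_abs)
  qed measurable
qed measurable

text \<open>The Gaussian weight makes both sides integrable, \<open>f\<close> being only square
  integrable and the inverse transform only known to be bounded; then uniqueness applies.\<close>

lemma L2_fourier_inversion:
  assumes f: "square_integrable f" and \<phi>: "is_L2_fourier f \<phi>" "integrable lborel \<phi>"
  shows "AE x in lborel. f x = inverse_fourier \<phi> x"
proof -
  have [measurable]: "f \<in> borel_measurable borel" "\<phi> \<in> borel_measurable borel"
    using f \<phi> by (auto simp: square_integrable_def)
  have [measurable]: "inverse_fourier \<phi> \<in> borel_measurable borel"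
    unfolding inverse_fourier_def[abs_def] by measurable
  let ?n = "\<lambda>x. complex_of_real (std_normal_density x)"
  have fn: "integrable lborel (\<lambda>x. f x * ?n x)" by (rule square_integrable_mult_gauss[OF f])
  have \<psi>n: "integrable lborel (\<lambda>x. inverse_fourier \<phi> x * ?n x)"
  proof (rule Bochner_Integration.integrable_bound)
    show "integrable lborel (\<lambda>x. complex_of_real (LINT y|lborel. cmod (\<phi> y)) * ?n x)"
      by (intro integrable_mult_right integrable_gauss)
    show "AE x in lborel. norm (inverse_fourier \<phi> x * ?n x)
        \<le> norm (complex_of_real (LINT y|lborel. cmod (\<phi> y)) * ?n x)"
    proof (rule AE_I2)
      fix x
      have "cmod (inverse_fourier \<phi> x) * std_normal_density x
          \<le> (LINT y|lborel. cmod (\<phi> y)) * std_normal_density x"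
        unfolding inverse_fourier_def by (intro mult_right_mono norm_fourier_integral_le) auto
      then show "norm (inverse_fourier \<phi> x * ?n x)
          \<le> norm (complex_of_real (LINT y|lborel. cmod (\<phi> y)) * ?n x)"
        by (simp add: norm_mult)
    qed
  qed measurable
  have eq: "(LINT x|lborel. f x * ?n x * cis (- 2 * pi * x * s))
      = (LINT x|lborel. inverse_fourier \<phi> x * ?n x * cis (- 2 * pi * x * s))" for s
  \<comment> \<open>Both sides are limits of the same integrals over \<open>{-R..R}\<close>: the
    left one by dominated convergence, the right one through the pairing identities.\<close>
  proof (rule tendsto_unique[OF trivial_limit_at_top_linorder])
    let ?h = "\<lambda>\<xi>. complex_of_real (std_normal_density (2 * pi * (\<xi> - s)))"
    let ?c = "complex_of_real (sqrt (2 * pi))"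
    let ?u = "\<lambda>x. f x * ?n x * cis (- 2 * pi * x * s)"
    have u: "integrable lborel ?u" by (intro integrable_mult_cis fn) measurable
    show "((\<lambda>R. LINT x|lborel. indicator {-R..R} x *\<^sub>R ?u x) \<longlongrightarrow> (LINT x|lborel. ?u x)) at_top"
    proof (rule integral_dominated_convergence_at_top[where w = "\<lambda>x. norm (?u x)"])
      show "AE x in lborel. ((\<lambda>R. indicator {-R..R} x *\<^sub>R ?u x) \<longlongrightarrow> ?u x) at_top"
      proof (rule AE_I2)
        fix x :: real
        have "eventually (\<lambda>R. indicator {-R..R} x *\<^sub>R ?u x = ?u x) at_top"
          using eventually_ge_at_top[of "\<bar>x\<bar>"] by eventually_elim (auto simp: indicator_def)
        then show "((\<lambda>R. indicator {-R..R} x *\<^sub>R ?u x) \<longlongrightarrow> ?u x) at_top"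
          by (rule tendsto_eventually)
      qed
    qed (use u in \<open>auto simp: indicator_def\<close>)
    have "((\<lambda>R. ?c * (LINT \<xi>|lborel. truncated_fourier f R \<xi> * ?h \<xi>))
        \<longlongrightarrow> ?c * (LINT \<xi>|lborel. \<phi> \<xi> * ?h \<xi>)) at_top"
      by (intro tendsto_intros truncated_fourier_tendsto f \<phi> square_integrable_gauss
          integrable_shifted_gauss)
    moreover have "?c * (LINT \<xi>|lborel. truncated_fourier f R \<xi> * ?h \<xi>)
        = (LINT x|lborel. indicator {-R..R} x *\<^sub>R ?u x)" for R
      unfolding truncated_fourier_gauss[OF f, symmetric]
      unfolding integral_mult_right_zero[symmetric] by (simp add: mult_ac)
    moreover have "?c * (LINT \<xi>|lborel. \<phi> \<xi> * ?h \<xi>)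
        = (LINT x|lborel. inverse_fourier \<phi> x * ?n x * cis (- 2 * pi * x * s))"
      unfolding inverse_fourier_gauss[OF \<phi>(2)]
      unfolding integral_mult_right_zero[symmetric] by (simp add: mult_ac)
    ultimately show "((\<lambda>R. LINT x|lborel. indicator {-R..R} x *\<^sub>R ?u x)
      \<longlongrightarrow> (LINT x|lborel. inverse_fourier \<phi> x * ?n x * cis (- 2 * pi * x * s))) at_top"
      by simp
  qed
  have "AE x in lborel. f x * ?n x - inverse_fourier \<phi> x * ?n x = 0"
  proof (rule AE_zero_of_fourier_zero)
    show "integrable lborel (\<lambda>x. f x * ?n x - inverse_fourier \<phi> x * ?n x)"
      using fn \<psi>n by simp
    show "(LINT x|lborel. (f x * ?n x - inverse_fourier \<phi> x * ?n x) * cis (t * x)) = 0" for t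
    proof -
      have "integrable lborel (\<lambda>x. f x * ?n x * cis (t * x))"
        "integrable lborel (\<lambda>x. inverse_fourier \<phi> x * ?n x * cis (t * x))"
        by (intro integrable_mult_cis fn \<psi>n; measurable)+
      \<comment> \<open>Every frequency \<open>t\<close> is reached by the translation
        \<open>s = - t / (2 * pi)\<close>.\<close>
      moreover have "- 2 * pi * x * (- t / (2 * pi)) = t * x" for x by simp
      ultimately show ?thesis using eq[of "- t / (2 * pi)"]
        by (simp only: left_diff_distrib Bochner_Integration.integral_diff diff_self)
    qed
  qed
  \<comment> \<open>The Gaussian vanishes nowhere and can be cancelled.\<close>
  then show ?thesis
    by eventually_elim (simp add: std_normal_density_def)
qed

subsection \<open>Regularity of the inverse Fourier transform\<close>

lemma norm_cis_minus_linear_le: "cmod (cis \<theta> - 1 - \<i> * complex_of_real \<theta>) \<le> \<theta>\<^sup>2 / 2"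
  using iexp_approx1[of \<theta> 1] by (simp add: cis_conv_exp algebra_simps numeral_2_eq_2)

text \<open>The second-order Taylor bound for \<open>cis\<close>, integrated against \<phi>, leaves
  an error of order \<open>(y - x)\<^sup>2\<close> whose constant is a finite second moment.\<close>

lemma has_vector_derivative_inverse_fourier:
  assumes int: "integrable lborel \<phi>" "integrable lborel (\<lambda>\<xi>. complex_of_real \<xi> * \<phi> \<xi>)"
    "integrable lborel (\<lambda>\<xi>. \<xi>\<^sup>2 * cmod (\<phi> \<xi>))"
  shows "(inverse_fourier \<phi> has_vector_derivative
      inverse_fourier (\<lambda>\<xi>. (2 * pi * \<i> * \<xi>) * \<phi> \<xi>) x) (at x)"
  unfolding has_vector_derivative_def
\<comment> \<open>The radius \<open>e = 1\<close> is arbitrary: the estimate holds for every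
  \<open>y \<noteq> x\<close>.\<close>
proof (rule has_derivativeI_sandwich[where e = 1])
  let ?\<psi>' = "inverse_fourier (\<lambda>\<xi>. (2 * pi * \<i> * \<xi>) * \<phi> \<xi>)"
  define K where "K = 2 * pi\<^sup>2 * (LINT \<xi>|lborel. \<xi>\<^sup>2 * cmod (\<phi> \<xi>))"
  show "norm (inverse_fourier \<phi> y - inverse_fourier \<phi> x - (y - x) *\<^sub>R ?\<psi>' x) / norm (y - x)
      \<le> K * \<bar>y - x\<bar>" if "y \<noteq> x" for y
  proof -
    let ?R = "\<lambda>\<xi>. \<phi> \<xi> * cis (2 * pi * x * \<xi>) *
      (cis (2 * pi * (y - x) * \<xi>) - 1 - \<i> * complex_of_real (2 * pi * (y - x) * \<xi>))"
    have int': "integrable lborel (\<lambda>\<xi>. (2 * pi * \<i> * \<xi>) * \<phi> \<xi>)"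
      using integrable_mult_right[OF int(2), of "2 * pi * \<i>"] by (simp add: mult_ac)
    have I: "integrable lborel (\<lambda>\<xi>. \<phi> \<xi> * cis (2 * pi * z * \<xi>))"
      "integrable lborel (\<lambda>\<xi>. (2 * pi * \<i> * \<xi>) * \<phi> \<xi> * cis (2 * pi * z * \<xi>))" for z
      by (intro integrable_mult_cis int int'; measurable)+
    \<comment> \<open>Factoring out \<open>cis (2 * pi * x * \<xi>)\<close>, of modulus 1, leaves
      the Taylor remainder at \<open>2 * pi * (y - x) * \<xi>\<close>.\<close>
    have eq: "(\<lambda>\<xi>. \<phi> \<xi> * cis (2 * pi * y * \<xi>) - \<phi> \<xi> * cis (2 * pi * x * \<xi>)
          - (y - x) *\<^sub>R ((2 * pi * \<i> * \<xi>) * \<phi> \<xi> * cis (2 * pi * x * \<xi>))) = ?R"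
    proof
      fix \<xi>
      have "cis (2 * pi * y * \<xi>) = cis (2 * pi * x * \<xi>) * cis (2 * pi * (y - x) * \<xi>)"
        unfolding cis_mult by (simp add: algebra_simps)
      then show "\<phi> \<xi> * cis (2 * pi * y * \<xi>) - \<phi> \<xi> * cis (2 * pi * x * \<xi>)
          - (y - x) *\<^sub>R ((2 * pi * \<i> * \<xi>) * \<phi> \<xi> * cis (2 * pi * x * \<xi>)) = ?R \<xi>"
        by (simp add: scaleR_conv_of_real algebra_simps)
    qed
    have diff: "inverse_fourier \<phi> y - inverse_fourier \<phi> x - (y - x) *\<^sub>R ?\<psi>' x
      = (LINT \<xi>|lborel. \<phi> \<xi> * cis (2 * pi * y * \<xi>) - \<phi> \<xi> * cis (2 * pi * x * \<xi>)
          - (y - x) *\<^sub>R ((2 * pi * \<i> * \<xi>) * \<phi> \<xi> * cis (2 * pi * x * \<xi>)))"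
      unfolding inverse_fourier_def using I
      by (subst Bochner_Integration.integral_diff) (auto intro!: Bochner_Integration.integrable_diff)
    have "cmod (LINT \<xi>|lborel. ?R \<xi>) \<le> (LINT \<xi>|lborel. (2 * pi\<^sup>2 * (y - x)\<^sup>2) * (\<xi>\<^sup>2 * cmod (\<phi> \<xi>)))"
    proof (rule Bochner_Integration.integral_norm_bound_integral)
      have "integrable lborel (\<lambda>\<xi>. \<phi> \<xi> * cis (2 * pi * y * \<xi>) - \<phi> \<xi> * cis (2 * pi * x * \<xi>)
          - (y - x) *\<^sub>R ((2 * pi * \<i> * \<xi>) * \<phi> \<xi> * cis (2 * pi * x * \<xi>)))"
        by (intro Bochner_Integration.integrable_diff integrable_scaleR_right I)
      then show "integrable lborel ?R" unfolding eq .
      fix \<xi>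
      have "cmod (?R \<xi>) = cmod (\<phi> \<xi>) * cmod (cis (2 * pi * (y - x) * \<xi>) - 1 - \<i> * complex_of_real (2 * pi * (y - x) * \<xi>))"
        by (simp only: norm_mult norm_cis mult_1_right)
      also have "\<dots> \<le> cmod (\<phi> \<xi>) * ((2 * pi * (y - x) * \<xi>)\<^sup>2 / 2)"
        by (intro mult_left_mono norm_cis_minus_linear_le) auto
      also have "\<dots> = (2 * pi\<^sup>2 * (y - x)\<^sup>2) * (\<xi>\<^sup>2 * cmod (\<phi> \<xi>))"
        by (simp add: power_mult_distrib)
      finally show "cmod (?R \<xi>) \<le> (2 * pi\<^sup>2 * (y - x)\<^sup>2) * (\<xi>\<^sup>2 * cmod (\<phi> \<xi>))" .
    qed (use int in auto)
    also have "\<dots> = K * \<bar>y - x\<bar> * \<bar>y - x\<bar>"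
    proof -
      have sq: "(y - x)\<^sup>2 = \<bar>y - x\<bar> * \<bar>y - x\<bar>" by (simp add: power2_eq_square)
      show ?thesis unfolding integral_mult_right_zero K_def sq by (simp only: mult_ac)
    qed
    finally show ?thesis using that unfolding diff eq by (simp add: divide_le_eq)
  qed
  have "((\<lambda>y. K * \<bar>y - x\<bar>) \<longlongrightarrow> K * \<bar>x - x\<bar>) (at x)" by (intro tendsto_intros)
  then show "((\<lambda>y. K * \<bar>y - x\<bar>) \<longlongrightarrow> 0) (at x)" by simp
qed (auto intro: bounded_linear_scaleR_left)

lemma
  fixes \<phi> :: "real \<Rightarrow> complex"
  assumes int: "\<And>p. integrable lborel (\<lambda>\<xi>. complex_of_real \<xi> ^ p * \<phi> \<xi>)"
  shows nth_deriv_inverse_fourier: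
      "nth_deriv p (inverse_fourier \<phi>) = inverse_fourier (\<lambda>\<xi>. (2 * pi * \<i> * \<xi>) ^ p * \<phi> \<xi>)"
    and smooth_inverse_fourier: "smooth (inverse_fourier \<phi>)"
proof -
  let ?D = "\<lambda>p \<xi>. (2 * pi * \<i> * \<xi>) ^ p * \<phi> \<xi>"
  \<comment> \<open>Moments of \<open>?D p\<close> are again moments of \<phi>, so the
    differentiation lemma can be iterated; it uses \<open>k = 0, 1, 2\<close>.\<close>
  have D: "integrable lborel (\<lambda>\<xi>. complex_of_real \<xi> ^ k * ?D p \<xi>)" for k p
    using integrable_mult_right[OF int[of "k + p"], of "(2 * pi * \<i>) ^ p"]
    by (simp add: power_mult_distrib power_add mult_ac)
  have deriv: "(inverse_fourier (?D p) has_vector_derivative inverse_fourier (?D (Suc p)) x) (at x)" for p x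
  proof -
    have "(inverse_fourier (?D p) has_vector_derivative
        inverse_fourier (\<lambda>\<xi>. (2 * pi * \<i> * \<xi>) * ?D p \<xi>) x) (at x)"
    proof (rule has_vector_derivative_inverse_fourier)
      show "integrable lborel (\<lambda>\<xi>. \<xi>\<^sup>2 * cmod (?D p \<xi>))"
        using integrable_norm[OF D[of 2 p]] by (simp only: norm_mult norm_power norm_of_real power2_abs)
    qed (use D[of 0 p] D[of 1 p] in simp_all)
    then show ?thesis by (simp add: mult.assoc)
  qed
  have *: "nth_deriv p (inverse_fourier \<phi>) = inverse_fourier (?D p)" for p
  proof (induction p)
    case (Suc p)
    then show ?case
      using deriv[of p] by (auto simp: nth_deriv_def vector_derivative_at)
  qed (simp add: nth_deriv_def)
  show "nth_deriv p (inverse_fourier \<phi>) = inverse_fourier (?D p)" by (rule *)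
  show "smooth (inverse_fourier \<phi>)"
    unfolding smooth_def * using deriv differentiableI_vector by blast
qed

section \<open>Extended Gevrey bounds and conclusion\<close>

lemma integrable_inverse_1_plus_square_lborel: "integrable lborel (\<lambda>x::real. inverse (1 + x\<^sup>2))"
  using integrable_inverse_1_plus_square by (simp add: set_integrable_def einterval_eq)

lemma inverse_fourier_Gamma_class:
  assumes "\<sigma> > 1" and \<phi>: "\<phi> \<in> Gamma_class \<sigma>"
  shows "integrable lborel \<phi>" "inverse_fourier \<phi> \<in> ext_Gevrey \<sigma>"
proof -
  obtain C \<tau> where C: "C \<ge> 1" "\<tau> > 0"
    and bound: "\<And>p x. (1 + \<bar>x\<bar>) ^ (p + 2) * cmod (\<phi> x) \<le> C powr (real p powr \<sigma> + 1) * M_seq \<tau> \<sigma> p"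
    using Gamma_class_moment_bound[OF assms] by blast
  have [measurable]: "\<phi> \<in> borel_measurable borel"
    using \<phi> by (auto simp: Gamma_class_def intro: borel_measurable_continuous_onI)
  define A where "A p = C powr (real p powr \<sigma> + 1) * M_seq \<tau> \<sigma> p" for p
  have A: "A p \<ge> 0" for p by (simp add: A_def M_seq_def)
  \<comment> \<open>The two spare powers of \<open>1 + \<bar>x\<bar>\<close> are spent on
    \<open>1 + x\<^sup>2 \<le> (1 + \<bar>x\<bar>)\<^sup>2\<close>.\<close>
  have pointwise: "cmod (complex_of_real x ^ p * \<phi> x) \<le> A p * inverse (1 + x\<^sup>2)" for p x
  proof -
    have "(1 + x\<^sup>2) * (\<bar>x\<bar> ^ p * cmod (\<phi> x)) \<le> (1 + \<bar>x\<bar>)\<^sup>2 * ((1 + \<bar>x\<bar>) ^ p * cmod (\<phi> x))"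
      by (intro mult_mono power_mono) (auto simp: power2_sum)
    also have "\<dots> \<le> A p" using bound[of x p] by (simp add: A_def power_add power2_eq_square mult_ac)
    finally have "(1 + x\<^sup>2) * (\<bar>x\<bar> ^ p * cmod (\<phi> x)) \<le> A p" .
    moreover have "1 + x\<^sup>2 > 0" by (simp add: add_pos_nonneg)
    ultimately show ?thesis by (simp add: norm_mult norm_power field_simps)
  qed
  have int: "integrable lborel (\<lambda>x. complex_of_real x ^ p * \<phi> x)" for p
  proof (rule Bochner_Integration.integrable_bound)
    show "integrable lborel (\<lambda>x. A p * inverse (1 + x\<^sup>2))"
      by (intro integrable_mult_right integrable_inverse_1_plus_square_lborel)
    show "AE x in lborel. norm (complex_of_real x ^ p * \<phi> x) \<le> norm (A p * inverse (1 + x\<^sup>2))"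
      using pointwise by (auto intro!: order.trans[OF _ abs_ge_self])
  qed measurable
  from int[of 0] show "integrable lborel \<phi>" by simp
  \<comment> \<open>The maximum with 1 lets \<open>I\<close> be raised to the power
    \<open>real p powr \<sigma> + 1\<close>.\<close>
  define I where "I = max 1 (LINT x|lborel. inverse (1 + (x::real)\<^sup>2))"
  define B where "B = 2 * pi * I * C"
  have "I \<ge> 1" by (simp add: I_def)
  have "2 * pi \<ge> 1" using pi_gt3 by simp
  have "cmod (nth_deriv p (inverse_fourier \<phi>) x) \<le> B powr (real p powr \<sigma> + 1) * M_seq \<tau> \<sigma> p" for p x
  proof -
    have "cmod (nth_deriv p (inverse_fourier \<phi>) x)
        \<le> (LINT \<xi>|lborel. cmod ((2 * pi * \<i> * \<xi>) ^ p * \<phi> \<xi>))"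
      unfolding nth_deriv_inverse_fourier[OF int] unfolding inverse_fourier_def
      by (rule norm_fourier_integral_le)
    also have "\<dots> = (LINT \<xi>|lborel. (2 * pi) ^ p * cmod (complex_of_real \<xi> ^ p * \<phi> \<xi>))"
      by (simp add: norm_mult norm_power power_mult_distrib mult_ac)
    also have "\<dots> \<le> (LINT \<xi>|lborel. (2 * pi) ^ p * (A p * inverse (1 + \<xi>\<^sup>2)))"
      by (intro integral_mono mult_left_mono pointwise integrable_mult_right integrable_norm int
          integrable_inverse_1_plus_square_lborel) auto
    also have "\<dots> = (2 * pi) ^ p * (A p * (LINT \<xi>|lborel. inverse (1 + \<xi>\<^sup>2)))"
      by simp
    also have "\<dots> \<le> (2 * pi) powr (real p powr \<sigma> + 1) * (A p * I powr (real p powr \<sigma> + 1))"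
    proof (intro mult_mono order.refl A)
      \<comment> \<open>This inequality, where \<open>\<sigma> > 1\<close> enters, absorbs
        \<open>(2 * pi) ^ p\<close> into the constant \<open>B\<close>.\<close>
      have "real p \<le> real p powr \<sigma> + 1"
      proof (cases "p = 0")
        case False
        then have "real p powr 1 \<le> real p powr \<sigma>" using assms by (intro powr_mono) auto
        then show ?thesis by simp
      qed simp
      then have "(2 * pi) powr real p \<le> (2 * pi) powr (real p powr \<sigma> + 1)"
        using \<open>2 * pi \<ge> 1\<close> by (intro powr_mono)
      then show "(2 * pi) ^ p \<le> (2 * pi) powr (real p powr \<sigma> + 1)"
        by (simp add: powr_realpow)
      have "I powr 1 \<le> I powr (real p powr \<sigma> + 1)" using \<open>I \<ge> 1\<close> by (intro powr_mono) auto
      then show "(LINT \<xi>|lborel. inverse (1 + \<xi>\<^sup>2)) \<le> I powr (real p powr \<sigma> + 1)"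
        using \<open>I \<ge> 1\<close> unfolding I_def by simp
    qed (auto intro!: A mult_nonneg_nonneg Bochner_Integration.integral_nonneg)
    also have "\<dots> = B powr (real p powr \<sigma> + 1) * M_seq \<tau> \<sigma> p"
      using C \<open>I \<ge> 1\<close> by (simp add: A_def B_def powr_mult)
    finally show ?thesis .
  qed
  moreover have "B > 0" using C \<open>I \<ge> 1\<close> by (simp add: B_def)
  \<comment> \<open>The bound is uniform in \<open>x\<close>, so the same \<open>B\<close> serves
    every compact set.\<close>
  ultimately have "inverse_fourier \<phi> \<in> ext_Gevrey_tau \<tau> \<sigma>"
    unfolding ext_Gevrey_tau_def using smooth_inverse_fourier[OF int] by blast
  then show "inverse_fourier \<phi> \<in> ext_Gevrey \<sigma>" using C unfolding ext_Gevrey_def by blast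
qed

text \<open>Equality in L2 is modulo null sets, so the second inclusion provides a representative,
  namely the inverse Fourier transform.\<close>

theorem lemma3p7:
  fixes \<sigma> :: real
  assumes "\<sigma> > 1"
  shows "N_class \<sigma> \<subseteq> E_Gamma \<sigma> \<and>
         (\<forall>f\<in>E_Gamma \<sigma>. \<exists>\<phi>\<in>ext_Gevrey \<sigma>. AE x in lborel. f x = \<phi> x)"
proof (intro conjI ballI)
  show "N_class \<sigma> \<subseteq> E_Gamma \<sigma>" by (rule N_class_subset_E_Gamma[OF assms])
  fix f assume "f \<in> E_Gamma \<sigma>"
  then obtain \<phi> where "square_integrable f" "\<phi> \<in> Gamma_class \<sigma>" "is_L2_fourier f \<phi>"
    unfolding E_Gamma_def by blast
  with inverse_fourier_Gamma_class[OF assms] L2_fourier_inversion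
  show "\<exists>\<phi>\<in>ext_Gevrey \<sigma>. AE x in lborel. f x = \<phi> x" by blast
qed

end
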